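(* Let $n\ge 3$ and let $(\mathcal{N},[\cdot,\dots,\cdot],\alpha=(\alpha_1,\dots,\alpha_{n-1}),B,\beta)$ be a Hom-quadratic $n$-ary Hom-Nambu algebra. Suppose $a\in\mathcal{N}$ satisfies $$\alpha_1(a)=a\quad\text{and}\quad [a,x_1,\dots,x_{n-2},a]=0\quad\text{for all } x_i\in\mathcal{N}.$$ Then $\mathcal{N}_a=(\mathcal{N},[\cdot,\dots,\cdot]_a,\alpha_a=(\alpha_2,\dots,\alpha_{n-1}),B,\beta)$, where $$[x_1,\dots,x_{n-1}]_a=[a,x_1,\dots,x_{n-1}]\quad\text{for all } x_i\in\mathcal{N},$$ is a Hom-quadratic $(n-1)$-ary Hom-Nambu algebra.
   Context: $\mathbb{K}$ is an algebraically closed field of characteristic zero. An $n$-ary Hom-Nambu algebra is a triple $(\mathcal{N},[\cdot,\dots,\cdot],\alpha)$ with $\mathcal{N}$ a $\mathbb{K}$-vector space, $[\cdot,\dots,\cdot]:\mathcal{N}^n\to\mathcal{N}$ an $n$-linear map and $\alpha=(\alpha_1,\dots,\alpha_{n-1})$ a family of linear maps $\mathcal{N}\to\mathcal{N}$ such that $$[\alpha_1(x_1),\dots,\alpha_{n-1}(x_{n-1}),[y_1,\dots,y_n]]=\sum_{i=1}^n[\alpha_1(y_1),\dots,\alpha_{i-1}(y_{i-1}),[x_1,\dots,x_{n-1},y_i],\alpha_i(y_{i+1}),\dots,\alpha_{n-1}(y_n)].$$ $(\mathcal{N},[\cdot,\dots,\cdot],\alpha,B,\beta)$ is a Hom-quadratic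 $n$-ary Hom-Nambu algebra if $B$ is a nondegenerate symmetric bilinear form and $\beta\in End(\mathcal{N})$ satisfies $B([x_1,\dots,x_{n-1},y],\beta(z))+B(\beta(y),[x_1,\dots,x_{n-1},z])=0$ for all elements. *)

theory Defs
  imports "HOL-Computational_Algebra.Polynomial"
begin

text \<open>
  An \<open>n\<close>-ary operation on a vector space is a function on lists of which only the values on
  lists of length \<open>n\<close> matter; a family \<open>(\<alpha>\<^sub>1, \<dots>, \<alpha>\<^sub>n\<^sub>-\<^sub>1)\<close> of linear maps is a list of length
  \<open>n - 1\<close>. List positions count from 0, so \<open>\<alpha>\<^sub>i\<close> is \<open>\<alpha> ! (i - 1)\<close>.
\<close>

definition multilinear_on_lists ::
  "('k::field \<Rightarrow> 'v::ab_group_add \<Rightarrow> 'v) \<Rightarrow> nat \<Rightarrow> ('v list \<Rightarrow> 'v) \<Rightarrow> bool" where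
  "multilinear_on_lists scale n f \<longleftrightarrow>
     (\<forall>xs i. length xs = n \<longrightarrow> i < n \<longrightarrow> Vector_Spaces.linear scale scale (\<lambda>v. f (xs[i := v])))"

definition bilinear_form ::
  "('k::field \<Rightarrow> 'v::ab_group_add \<Rightarrow> 'v) \<Rightarrow> ('v \<Rightarrow> 'v \<Rightarrow> 'k) \<Rightarrow> bool" where
  "bilinear_form scale B \<longleftrightarrow>
     (\<forall>x. Vector_Spaces.linear scale (*) (\<lambda>y. B x y)) \<and>
     (\<forall>y. Vector_Spaces.linear scale (*) (\<lambda>x. B x y))"

abbreviation apply_maps :: "('v \<Rightarrow> 'v) list \<Rightarrow> 'v list \<Rightarrow> 'v list" where
  "apply_maps fs xs \<equiv> map2 (\<lambda>f x. f x) fs xs"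

text \<open>
  In the Hom-Nambu identity below, the summand for position \<open>i\<close> (counted from 0) is
  \<open>[\<alpha>\<^sub>1(y\<^sub>1), \<dots>, \<alpha>\<^sub>i(y\<^sub>i), [x\<^sub>1, \<dots>, x\<^sub>n\<^sub>-\<^sub>1, y\<^sub>i\<^sub>+\<^sub>1], \<alpha>\<^sub>i\<^sub>+\<^sub>1(y\<^sub>i\<^sub>+\<^sub>2), \<dots>, \<alpha>\<^sub>n\<^sub>-\<^sub>1(y\<^sub>n)]\<close>.
  No symmetry of the bracket is assumed.
\<close>

locale hom_nambu_algebra = vector_space scale
  for scale :: "'k::{alg_closed_field, field_char_0} \<Rightarrow> 'v::ab_group_add \<Rightarrow> 'v" +
  fixes n :: nat
    and bracket :: "'v list \<Rightarrow> 'v"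
    and \<alpha> :: "('v \<Rightarrow> 'v) list"
  assumes arity_pos: "n \<ge> 1"
    and multilinear_bracket: "multilinear_on_lists scale n bracket"
    and length_twists: "length \<alpha> = n - 1"
    and linear_twists: "\<And>f. f \<in> set \<alpha> \<Longrightarrow> Vector_Spaces.linear scale scale f"
    and hom_nambu_identity:
      "\<And>xs ys. length xs = n - 1 \<Longrightarrow> length ys = n \<Longrightarrow>
         bracket (apply_maps \<alpha> xs @ [bracket ys]) =
         (\<Sum>i<n. bracket (apply_maps (take i \<alpha>) (take i ys)
                          @ [bracket (xs @ [ys ! i])]
                          @ apply_maps (drop i \<alpha>) (drop (Suc i) ys)))"

locale hom_quadratic_hom_nambu_algebra = hom_nambu_algebra scale n bracket \<alpha>
  for scale :: "'k::{alg_closed_field, field_char_0} \<Rightarrow> 'v::ab_group_add \<Rightarrow> 'v"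
    and n :: nat
    and bracket :: "'v list \<Rightarrow> 'v"
    and \<alpha> :: "('v \<Rightarrow> 'v) list" +
  fixes B :: "'v \<Rightarrow> 'v \<Rightarrow> 'k"
    and \<beta> :: "'v \<Rightarrow> 'v"
  assumes bilinear_B: "bilinear_form scale B"
    and symmetric_B: "\<And>x y. B x y = B y x"
    and nondegenerate_B: "\<And>x. (\<And>y. B x y = 0) \<Longrightarrow> x = 0"
    and linear_\<beta>: "Vector_Spaces.linear scale scale \<beta>"
    and hom_invariant_B:
      "\<And>xs y z. length xs = n - 1 \<Longrightarrow>
         B (bracket (xs @ [y])) (\<beta> z) + B (\<beta> y) (bracket (xs @ [z])) = 0"

end

theory Submission
  imports Defs
begin

text \<open>
  The Hom-Nambu identity of the reduced bracket is the original one with \<open>a\<close> prepended to both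
  argument lists: \<open>\<alpha>\<^sub>1(a) = a\<close> turns the remaining summands into reduced ones, and the first
  summand vanishes because it contains the entry \<open>[a, x\<^sub>1, \<dots>, x\<^sub>n\<^sub>-\<^sub>2, a] = 0\<close>.
\<close>

text \<open>Writing 0 into slot \<open>i\<close> leaves \<open>xs\<close> unchanged, and a linear
  map of that slot sends 0 to 0.\<close>

lemma multilinear_on_lists_eq_0:
  assumes "multilinear_on_lists scale n f" and "length xs = n" and "i < n" and "xs ! i = 0"
  shows "f xs = 0"
proof -
  interpret Vector_Spaces.linear scale scale "\<lambda>v. f (xs[i := v])"
    using assms unfolding multilinear_on_lists_def by blast
  have "xs[i := 0] = xs"
    using assms(4) by (metis list_update_id)
  then show ?thesis
    using zero by simp
qed

text \<open>Slot \<open>i\<close> of the shorter list is slot \<open>Suc i\<close> once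
  \<open>a\<close> is in front.\<close>

lemma multilinear_on_lists_Cons:
  fixes f :: "'b list \<Rightarrow> 'b::ab_group_add"
  assumes "multilinear_on_lists scale (Suc n) f"
  shows "multilinear_on_lists scale n (\<lambda>xs. f (a # xs))"
  unfolding multilinear_on_lists_def
proof (intro allI impI)
  fix xs :: "'b list" and i
  assume "length xs = n" "i < n"
  then have "Vector_Spaces.linear scale scale (\<lambda>v. f ((a # xs)[Suc i := v]))"
    using assms unfolding multilinear_on_lists_def by (metis Suc_less_eq length_Cons)
  then show "Vector_Spaces.linear scale scale (\<lambda>v. f (a # xs[i := v]))"
    by simp
qed

theorem theorem5p12:
  fixes scale :: "'k::{alg_closed_field, field_char_0} \<Rightarrow> 'v::ab_group_add \<Rightarrow> 'v"
    and n :: nat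
    and bracket :: "'v list \<Rightarrow> 'v"
    and \<alpha> :: "('v \<Rightarrow> 'v) list"
    and B :: "'v \<Rightarrow> 'v \<Rightarrow> 'k"
    and \<beta> :: "'v \<Rightarrow> 'v"
    and a :: 'v
  assumes "n \<ge> 3"
    and "hom_quadratic_hom_nambu_algebra scale n bracket \<alpha> B \<beta>"
    and "(\<alpha> ! 0) a = a"
    and "\<And>xs. length xs = n - 2 \<Longrightarrow> bracket (a # xs @ [a]) = 0"
  shows "hom_quadratic_hom_nambu_algebra scale (n - 1) (\<lambda>xs. bracket (a # xs)) (tl \<alpha>) B \<beta>"
proof -
  interpret hom_quadratic_hom_nambu_algebra scale n bracket \<alpha> B \<beta>
    by (fact assms(2))
  obtain m where n: "n = Suc m" and m: "m \<ge> 2"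
    using assms(1) by (cases n) auto
  \<comment> \<open>There are \<open>m\<close> twists, so the family is nonempty: \<open>f\<close>
    is the twist fixing \<open>a\<close>, and \<open>fs\<close> is the reduced family.\<close>
  obtain f fs where \<alpha>: "\<alpha> = f # fs" and fs: "length fs = m - 1"
    using length_twists n m by (cases \<alpha>) auto
  have fa: "f a = a"
    using assms(3) \<alpha> by simp
  show ?thesis
    unfolding n \<alpha> diff_Suc_1 list.sel
  proof (intro hom_quadratic_hom_nambu_algebra.intro hom_nambu_algebra.intro
      hom_nambu_algebra_axioms.intro hom_quadratic_hom_nambu_algebra_axioms.intro)
    show "vector_space scale"
      by (fact vector_space_axioms)
    show "bilinear_form scale B"
      by (fact bilinear_B)
    show "B x y = B y x" for x y
      by (fact symmetric_B)
    show "x = 0" if "\<And>y. B x y = 0" for x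
      using nondegenerate_B that .
    show "Vector_Spaces.linear scale scale \<beta>"
      by (fact linear_\<beta>)
    show "1 \<le> m"
      using m by simp
    show "multilinear_on_lists scale m (\<lambda>xs. bracket (a # xs))"
      using multilinear_bracket n by (simp add: multilinear_on_lists_Cons)
    show "length fs = m - 1"
      by (fact fs)
    show "Vector_Spaces.linear scale scale g" if "g \<in> set fs" for g
      using that linear_twists \<alpha> by simp
    \<comment> \<open>This is the given invariance with \<open>a\<close> as the first of the
      \<open>n - 1\<close> fixed arguments.\<close>
    show "B (bracket (a # xs @ [y])) (\<beta> z) + B (\<beta> y) (bracket (a # xs @ [z])) = 0"
      if "length xs = m - 1" for xs y z
      using hom_invariant_B[of "a # xs" y z] that n m by simp
    show "bracket (a # apply_maps fs xs @ [bracket (a # ys)]) =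
        (\<Sum>i<m. bracket (a # apply_maps (take i fs) (take i ys)
                       @ [bracket (a # xs @ [ys ! i])]
                       @ apply_maps (drop i fs) (drop (Suc i) ys)))"
      if xs: "length xs = m - 1" and ys: "length ys = m" for xs ys
    proof -
      have "bracket (a # xs @ [a]) = 0"
        using assms(4) xs n by simp
      \<comment> \<open>At \<open>i = 0\<close> no twisted entry precedes the inner bracket, so its
        zero value sits in slot 0 and all of \<open>\<alpha>\<close> acts on
        \<open>ys\<close>.\<close>
      then have first_summand: "bracket (bracket (a # xs @ [a]) # apply_maps \<alpha> ys) = 0"
        using ys fs n m
        by (intro multilinear_on_lists_eq_0[OF multilinear_bracket, where i = 0]) (simp_all add: \<alpha>)
      have "bracket (apply_maps \<alpha> (a # xs) @ [bracket (a # ys)]) =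
         (\<Sum>i<Suc m. bracket (apply_maps (take i \<alpha>) (take i (a # ys))
                          @ [bracket ((a # xs) @ [(a # ys) ! i])]
                          @ apply_maps (drop i \<alpha>) (drop (Suc i) (a # ys))))"
        unfolding n[symmetric] by (rule hom_nambu_identity) (use xs ys n m in simp_all)
      then show ?thesis
        \<comment> \<open>The shift splits off index 0; since \<open>f a = a\<close>, index
          \<open>Suc i\<close> of the long sum is exactly index \<open>i\<close> of the reduced one.
          The rule \<open>sum.lessThan_Suc\<close> would split off the last index instead, hence its
          removal.\<close>
        using first_summand by (simp add: sum.lessThan_Suc_shift \<alpha> fa del: sum.lessThan_Suc)
    qed
  qed
qed

end
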